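(* Suppose that $\mathfrak C,\mathfrak C^n\in L(\mathcal H)$ for $n\ge1$. Let $\mathcal V$ and $\mathcal V^n$ be the variance processes given by $$d\mathcal V(t)=\mathfrak C\mathcal V(t)\,dt+d\mathcal L(t),\ \ \mathcal V(0)=\mathcal V_0,\qquad d\mathcal V^n(t)=\mathfrak C^n\mathcal V^n(t)\,dt+d\mathcal L^n(t),\ \ \mathcal V^n(0)=\mathcal V^n_0,$$ where $\mathcal V_0^n=\mathcal V_0$ and $\mathcal L^n=\mathcal L$ for all $n\ge1$, and $\mathcal L(t)=\sum_{i=1}^{N(t)}\mathcal X_i$ is a square-integrable $\mathcal H$-valued compound Poisson process. Then for every $T>0$, $$\mathbb E\Big[\sup_{0\le t\le T}\|\mathcal V(t)-\mathcal V^n(t)\|_{\mathcal H}^2\Big]\le C(T)\,\|\mathfrak C-\mathfrak C^n\|_{\mathrm{op}}^2,$$ where $$C(T)=2T^2e^{2T(\|\mathfrak C\|_{\mathrm{op}}\vee\|\mathfrak C^n\|_{\mathrm{op}})}\Big(\mathbb E[\|\mathcal V_0\|_{\mathcal H}^2]+\lambda T\,\mathbb E[\|\mathcal X_1\|_{\mathcal H}^2]+\lambda^2T^2\big(\mathbb E[\|\mathcal X_1\|_{\mathcal H}]\big)^2\Big).$$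
   Context: $H$ is a separable real Hilbert space and $\mathcal H=L_{HS}(H)$ is the Hilbert space of Hilbert-Schmidt operators on $H$ with norm $\|\cdot\|_{\mathcal H}$. $L(\mathcal H)$ is the Banach algebra of bounded linear operators on $\mathcal H$, with operator norm $\|\cdot\|_{\mathrm{op}}$; $x\vee y=\max(x,y)$. $N$ is a Poisson process with intensity $\lambda>0$ (right-continuous with left limits), and $(\mathcal X_i)_{i\ge1}$ are i.i.d. $\mathcal H$-valued random variables independent of $N$. $\mathcal V_0$ is an $\mathcal H$-valued initial value. The solution of $d\mathcal V(t)=\mathfrak C\mathcal V(t)dt+d\mathcal L(t)$, $\mathcal V(0)=\mathcal V_0$, is $\mathcal V(t)=e^{\mathfrak Ct}\mathcal V_0+\int_0^te^{\mathfrak C(t-s)}d\mathcal L(s)=e^{\mathfrak Ct}\mathcal V_0+\sum_{i:T_i\le t}e^{\mathfrak C(t-T_i)}\mathcal X_i$, with $T_i$ the jump times of $N$; similarly for $\mathcal V^n$ with $\mathfrak C^n$ in place of $\mathfrak C$. *)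

theory Defs
  imports "HOL-Probability.Probability"
begin

section \<open>Orthonormal bases of a separable Hilbert space\<close>

text \<open>Second countability is separability here, so \<open>{real_inner, banach, second_countable_topology}\<close>
  is the sort of separable real Hilbert spaces.\<close>

definition orthonormal_basis :: "'h::real_inner set \<Rightarrow> bool" where
  "orthonormal_basis B \<longleftrightarrow>
     pairwise orthogonal B \<and> (\<forall>e\<in>B. norm e = 1) \<and> closure (span B) = UNIV"

lemma orthonormal_extend:
  fixes S :: "'h::real_inner set"
  assumes "finite S" "pairwise orthogonal S" "\<forall>e\<in>S. norm e = 1"
  shows "\<exists>S'. finite S' \<and> S \<subseteq> S' \<and> pairwise orthogonal S' \<and> (\<forall>e\<in>S'. norm e = 1) \<and> x \<in> span S'"
proof (cases "x \<in> span S")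
  case True
  then show ?thesis using assms by blast
next
  case False
  define p where "p = (\<Sum>e\<in>S. (x \<bullet> e) *\<^sub>R e)"
  define u where "u = (1 / norm (x - p)) *\<^sub>R (x - p)"
  have p: "p \<in> span S" unfolding p_def by (intro span_sum span_scale span_base)
  have nz: "x - p \<noteq> 0" using p False by auto
  have orth: "(x - p) \<bullet> f = 0" if "f \<in> S" for f
  proof -
    have "p \<bullet> f = (\<Sum>e\<in>S. (x \<bullet> e) * (e \<bullet> f))" by (simp add: p_def inner_sum_left)
    also have "\<dots> = (\<Sum>e\<in>S. if e = f then x \<bullet> f else 0)"
    proof (rule sum.cong)
      fix e assume "e \<in> S"
      show "(x \<bullet> e) * (e \<bullet> f) = (if e = f then x \<bullet> f else 0)"
      proof (cases "e = f")
        case True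
        then show ?thesis using assms(3) \<open>f \<in> S\<close> by (simp add: dot_square_norm)
      next
        case False
        then show ?thesis using assms(2) \<open>f \<in> S\<close> \<open>e \<in> S\<close>
          by (auto simp: pairwise_def orthogonal_def)
      qed
    qed simp
    also have "\<dots> = x \<bullet> f" using assms(1) that by simp
    finally show ?thesis by (simp add: inner_diff_left)
  qed
  have "norm u = 1" using nz by (simp add: u_def)
  moreover have "orthogonal u f" "orthogonal f u" if "f \<in> S" for f
    using orth[OF that] by (auto simp: u_def orthogonal_def inner_commute)
  moreover have "x \<in> span (insert u S)"
  proof -
    have "x = norm (x - p) *\<^sub>R u + p" using nz by (simp add: u_def)
    moreover have "u \<in> span (insert u S)" by (simp add: span_base)
    moreover have "p \<in> span (insert u S)" using p span_mono[of S "insert u S"] by auto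
    ultimately show ?thesis by (metis span_add span_scale)
  qed
  ultimately show ?thesis using assms
    by (intro exI[of _ "insert u S"]) (auto simp: pairwise_insert)
qed

lemma ex_countable_orthonormal_basis:
  "\<exists>B::'h::{real_inner,banach,second_countable_topology} set. countable B \<and> orthonormal_basis B"
proof -
  obtain D :: "'h set" where D: "countable D" "\<And>X. open X \<Longrightarrow> X \<noteq> {} \<Longrightarrow> \<exists>d\<in>D. d \<in> X"
    by (rule countable_dense_setE) blast
  have "D \<noteq> {}" using D(2)[of UNIV] by auto
  define d where "d = from_nat_into D"
  have rd: "range d = D" unfolding d_def using \<open>D \<noteq> {}\<close> D(1) by simp
  define P where "P S \<longleftrightarrow> finite S \<and> pairwise orthogonal S \<and> (\<forall>e\<in>S. norm e = 1)" for S :: "'h set"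
  have "\<exists>F. \<forall>n. P (F n) \<and> (F n \<subseteq> F (Suc n) \<and> d n \<in> span (F (Suc n)))"
  proof (rule dependent_nat_choice)
    show "\<exists>S. P S" by (rule exI[of _ "{}"]) (simp add: P_def)
  next
    fix S n assume "P S"
    then show "\<exists>S'. P S' \<and> (S \<subseteq> S' \<and> d n \<in> span S')"
      using orthonormal_extend[of S "d n"] unfolding P_def by blast
  qed
  then obtain F where F: "\<And>n. P (F n)" "\<And>n. F n \<subseteq> F (Suc n)" "\<And>n. d n \<in> span (F (Suc n))"
    by blast
  have mono: "F m \<subseteq> F n" if "m \<le> n" for m n
    using F(2) that by (rule lift_Suc_mono_le)
  define B where "B = (\<Union>n. F n)"
  have "countable B" unfolding B_def using F(1) by (auto simp: P_def intro: countable_finite)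
  moreover have "pairwise orthogonal B"
  proof (rule pairwiseI)
    fix e f assume "e \<in> B" "f \<in> B" "e \<noteq> f"
    then obtain m n where "e \<in> F m" "f \<in> F n" by (auto simp: B_def)
    then have "e \<in> F (max m n)" "f \<in> F (max m n)" using mono by (meson max.cobounded1 max.cobounded2 subsetD)+
    then show "orthogonal e f" using F(1)[of "max m n"] \<open>e \<noteq> f\<close> by (auto simp: P_def pairwise_def)
  qed
  moreover have "\<forall>e\<in>B. norm e = 1" using F(1) by (auto simp: B_def P_def)
  moreover have "closure (span B) = UNIV"
  proof -
    have "D \<subseteq> span B"
    proof
      fix x assume "x \<in> D"
      then obtain n where "x = d n" using rd by auto
      then have "x \<in> span (F (Suc n))" using F(3) by simp
      moreover have "F (Suc n) \<subseteq> B" by (auto simp: B_def)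
      ultimately show "x \<in> span B" using span_mono by blast
    qed
    moreover have "x \<in> closure D" for x
      unfolding closure_iff_nhds_not_empty
    proof (intro allI impI)
      fix A U assume "U \<subseteq> A" "open U" "x \<in> U"
      with D(2)[of U] show "D \<inter> A \<noteq> {}" by auto
    qed
    ultimately show ?thesis using closure_mono by blast
  qed
  ultimately show ?thesis unfolding orthonormal_basis_def by blast
qed

lemma orthonormal_norm_sum:
  assumes "orthonormal_basis B" "finite F" "F \<subseteq> B"
  shows "(norm (\<Sum>e\<in>F. c e *\<^sub>R e))\<^sup>2 = (\<Sum>e\<in>F. (c e)\<^sup>2)"
proof -
  have "(norm (\<Sum>e\<in>F. c e *\<^sub>R e))\<^sup>2 = (\<Sum>e\<in>F. (norm (c e *\<^sub>R e))\<^sup>2)"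
    using assms by (intro norm_sum_Pythagorean)
      (auto simp: orthonormal_basis_def pairwise_def orthogonal_def subset_iff)
  also have "\<dots> = (\<Sum>e\<in>F. (c e)\<^sup>2)"
    using assms by (intro sum.cong) (auto simp: orthonormal_basis_def power_mult_distrib)
  finally show ?thesis .
qed

lemma functional_has_sum_norm:
  fixes \<phi> :: "'h::real_inner \<Rightarrow>\<^sub>L real"
  assumes B: "orthonormal_basis B"
  shows "((\<lambda>e. (\<phi> e)\<^sup>2) has_sum (norm \<phi>)\<^sup>2) B"
proof -
  have fin: "(\<Sum>e\<in>F. (\<phi> e)\<^sup>2) \<le> (norm \<phi>)\<^sup>2" if F: "finite F" "F \<subseteq> B" for F
  proof -
    define s where "s = (\<Sum>e\<in>F. (\<phi> e)\<^sup>2)"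
    define x where "x = (\<Sum>e\<in>F. \<phi> e *\<^sub>R e)"
    have s0: "s \<ge> 0" by (simp add: s_def sum_nonneg)
    have "(norm x)\<^sup>2 = s" using orthonormal_norm_sum[OF B F] by (simp add: x_def s_def)
    then have nx: "norm x = sqrt s" by (metis norm_ge_zero real_sqrt_unique)
    have "\<phi> x = s" by (simp add: x_def s_def blinfun.sum_right blinfun.scaleR_right power2_eq_square)
    then have "s \<le> norm \<phi> * sqrt s" using norm_blinfun[of \<phi> x] s0 nx by simp
    then have "sqrt s * sqrt s \<le> norm \<phi> * sqrt s" using s0 by simp
    then have "sqrt s \<le> norm \<phi>"
      by (metis linorder_le_less_linear mult_right_le_imp_le norm_ge_zero order_trans)
    then have "(sqrt s)\<^sup>2 \<le> (norm \<phi>)\<^sup>2" using s0 by (intro power_mono) auto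
    then show ?thesis using s0 by (simp add: s_def)
  qed
  have summ: "(\<lambda>e. (\<phi> e)\<^sup>2) summable_on B"
    by (rule nonneg_bdd_above_summable_on) (auto intro!: bdd_aboveI[of _ "(norm \<phi>)\<^sup>2"] fin)
  define s where "s = (\<Sum>\<^sub>\<infinity>e\<in>B. (\<phi> e)\<^sup>2)"
  have s0: "s \<ge> 0" unfolding s_def by (rule infsum_nonneg) simp
  have le: "s \<le> (norm \<phi>)\<^sup>2"
    unfolding s_def by (rule infsum_le_finite_sums[OF summ]) (rule fin)
  have spn: "\<bar>\<phi> x\<bar> \<le> sqrt s * norm x" if x: "x \<in> span B" for x
  proof -
    obtain F c where F: "finite F" "F \<subseteq> B" "x = (\<Sum>e\<in>F. c e *\<^sub>R e)"
      using x unfolding span_explicit by auto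
    have "(\<phi> x)\<^sup>2 = (\<Sum>e\<in>F. c e * \<phi> e)\<^sup>2"
      by (simp add: F(3) blinfun.sum_right blinfun.scaleR_right)
    also have "\<dots> \<le> (\<Sum>e\<in>F. (c e)\<^sup>2) * (\<Sum>e\<in>F. (\<phi> e)\<^sup>2)" by (rule Cauchy_Schwarz_ineq_sum)
    also have "\<dots> = (norm x)\<^sup>2 * (\<Sum>e\<in>F. (\<phi> e)\<^sup>2)"
      using orthonormal_norm_sum[OF B F(1,2)] F(3) by simp
    also have "\<dots> \<le> (norm x)\<^sup>2 * s"
      unfolding s_def by (intro mult_left_mono finite_sum_le_infsum[OF summ]) (use F in auto)
    also have "\<dots> = (sqrt s * norm x)\<^sup>2" using s0 by (simp add: power_mult_distrib)
    finally show ?thesis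
      using s0 by (metis abs_le_square_iff abs_mult abs_norm_cancel abs_of_nonneg real_sqrt_ge_zero)
  qed
  have "closed {x. \<bar>\<phi> x\<bar> \<le> sqrt s * norm x}"
    by (intro closed_Collect_le continuous_intros)
  then have "closure (span B) \<subseteq> {x. \<bar>\<phi> x\<bar> \<le> sqrt s * norm x}"
    by (intro closure_minimal) (use spn in auto)
  then have "\<bar>\<phi> x\<bar> \<le> sqrt s * norm x" for x
    using B by (auto simp: orthonormal_basis_def)
  then have "norm \<phi> \<le> sqrt s" using s0 by (intro norm_blinfun_bound) auto
  then have "(norm \<phi>)\<^sup>2 \<le> s" using s0 real_le_rsqrt sqrt_le_D
    by (metis norm_ge_zero power_mono real_sqrt_pow2)
  then show ?thesis using le summ by (simp add: has_sum_iff s_def)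
qed

section \<open>Hilbert--Schmidt operators\<close>

definition hilbert_schmidt :: "('h::real_inner \<Rightarrow>\<^sub>L 'h) \<Rightarrow> bool" where
  "hilbert_schmidt A \<longleftrightarrow> (\<exists>B. orthonormal_basis B \<and> (\<lambda>e. (norm (A e))\<^sup>2) summable_on B)"

text \<open>The Hilbert--Schmidt property, norm and inner product do not depend on the basis.\<close>

definition coord_functional :: "('h::real_inner \<Rightarrow>\<^sub>L 'h) \<Rightarrow> 'h \<Rightarrow> 'h \<Rightarrow>\<^sub>L real" where
  "coord_functional A f = blinfun_inner_left f o\<^sub>L A"

lemma coord_functional_apply [simp]: "coord_functional A f x = A x \<bullet> f"
  by (simp add: coord_functional_def)

lemma parseval:
  fixes x :: "'h::real_inner"
  assumes "orthonormal_basis B"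
  shows "((\<lambda>e. (x \<bullet> e)\<^sup>2) has_sum (norm x)\<^sup>2) B"
proof -
  have "norm (blinfun_inner_right x) = norm x"
  proof (rule antisym)
    show "norm (blinfun_inner_right x) \<le> norm x"
      by (rule norm_blinfun_bound) (auto simp: Cauchy_Schwarz_ineq2)
    have "norm x * norm x \<le> norm (blinfun_inner_right x) * norm x"
      using norm_blinfun[of "blinfun_inner_right x" x]
      by (simp add: power2_norm_eq_inner[symmetric] power2_eq_square)
    then show "norm x \<le> norm (blinfun_inner_right x)"
      by (cases "x = 0") auto
  qed
  then show ?thesis using functional_has_sum_norm[OF assms, of "blinfun_inner_right x"] by simp
qed

lemma has_sum_basis_indep:
  fixes A :: "'h::real_inner \<Rightarrow>\<^sub>L 'h"
  assumes B: "orthonormal_basis B" and B': "orthonormal_basis B'"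
    and s: "((\<lambda>e. (norm (A e))\<^sup>2) has_sum S) B"
  shows "((\<lambda>e. (norm (A e))\<^sup>2) has_sum S) B'"
proof -
  have *: "((\<lambda>f. (norm (coord_functional A f))\<^sup>2) has_sum S) B"
  proof -
    have 1: "((\<lambda>f. (case (e, f) of (e, f) \<Rightarrow> (A e \<bullet> f)\<^sup>2)) has_sum (norm (A e))\<^sup>2) B" for e
      using parseval[OF B] by simp
    have 2: "(\<lambda>(e, f). (A e \<bullet> f)\<^sup>2) summable_on B \<times> B"
      by (rule summable_on_SigmaI[OF 1]) (use s in \<open>auto simp: has_sum_imp_summable\<close>)
    have "((\<lambda>(e, f). (A e \<bullet> f)\<^sup>2) has_sum S) (B \<times> B)"
      by (rule has_sum_SigmaI[OF 1 s 2])
    then have "((\<lambda>(f, e). (A e \<bullet> f)\<^sup>2) has_sum S) (B \<times> B)"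
      by (subst (asm) has_sum_swap) (simp add: case_prod_unfold)
    then show ?thesis
      by (rule has_sum_SigmaD) (use functional_has_sum_norm[OF B, of "coord_functional A _"] in simp)
  qed
  have 1: "((\<lambda>e. (case (f, e) of (f, e) \<Rightarrow> (A e \<bullet> f)\<^sup>2)) has_sum (norm (coord_functional A f))\<^sup>2) B'" for f
    using functional_has_sum_norm[OF B', of "coord_functional A f"] by simp
  have 2: "(\<lambda>(f, e). (A e \<bullet> f)\<^sup>2) summable_on B \<times> B'"
    by (rule summable_on_SigmaI[OF 1]) (use * in \<open>auto simp: has_sum_imp_summable\<close>)
  have "((\<lambda>(f, e). (A e \<bullet> f)\<^sup>2) has_sum S) (B \<times> B')"
    by (rule has_sum_SigmaI[OF 1 * 2])
  then have "((\<lambda>(e, f). (A e \<bullet> f)\<^sup>2) has_sum S) (B' \<times> B)"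
    by (subst (asm) has_sum_swap) (simp add: case_prod_unfold)
  then show ?thesis
    by (rule has_sum_SigmaD) (use parseval[OF B] in simp)
qed

lemma hilbert_schmidt_iff:
  assumes "orthonormal_basis B"
  shows "hilbert_schmidt A \<longleftrightarrow> (\<lambda>e. (norm (A e))\<^sup>2) summable_on B"
  using assms has_sum_basis_indep unfolding hilbert_schmidt_def summable_on_def by metis

definition hs_basis :: "'h::{real_inner,banach,second_countable_topology} set" where
  "hs_basis = (SOME B. countable B \<and> orthonormal_basis B)"

lemma hs_basis: "countable (hs_basis :: 'h::{real_inner,banach,second_countable_topology} set)"
    "orthonormal_basis (hs_basis :: 'h set)"
  using someI_ex[OF ex_countable_orthonormal_basis[where 'h='h]] by (auto simp: hs_basis_def)

lemmas hilbert_schmidt_basis = hilbert_schmidt_iff[OF hs_basis(2)]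

typedef (overloaded) 'h hs_op = "{A :: 'h::{real_inner,banach,second_countable_topology} \<Rightarrow>\<^sub>L 'h. hilbert_schmidt A}"
  morphisms blinfun_of_hs Abs_hs
  by (rule exI[of _ 0]) (simp add: hilbert_schmidt_basis)

setup_lifting type_definition_hs_op

lemma hilbert_schmidt_add:
  fixes A :: "'h::{real_inner,banach,second_countable_topology} \<Rightarrow>\<^sub>L 'h"
  assumes "hilbert_schmidt A" "hilbert_schmidt A'"
  shows "hilbert_schmidt (A + A')"
  unfolding hilbert_schmidt_basis
proof (rule summable_on_comparison_test)
  show "(\<lambda>e. 2 * (norm (A e))\<^sup>2 + 2 * (norm (A' e))\<^sup>2) summable_on hs_basis"
    using assms unfolding hilbert_schmidt_basis
    by (intro summable_on_add summable_on_cmult_right)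
next
  fix e
  have "(norm (A e + A' e))\<^sup>2 \<le> (norm (A e) + norm (A' e))\<^sup>2"
    by (intro power_mono norm_triangle_ineq) simp
  also have "\<dots> \<le> 2 * (norm (A e))\<^sup>2 + 2 * (norm (A' e))\<^sup>2"
    using sum_squares_bound[of "norm (A e)" "norm (A' e)"] by (simp add: power2_sum)
  finally show "(norm ((A + A') e))\<^sup>2 \<le> 2 * (norm (A e))\<^sup>2 + 2 * (norm (A' e))\<^sup>2"
    by (simp add: blinfun.add_left)
qed simp

lemma hilbert_schmidt_scaleR:
  fixes A :: "'h::{real_inner,banach,second_countable_topology} \<Rightarrow>\<^sub>L 'h"
  assumes "hilbert_schmidt A"
  shows "hilbert_schmidt (r *\<^sub>R A)"
  using assms unfolding hilbert_schmidt_basis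
  by (auto simp: blinfun.scaleR_left power_mult_distrib intro!: summable_on_cmult_right)

lemma hilbert_schmidt_uminus:
  fixes A :: "'h::{real_inner,banach,second_countable_topology} \<Rightarrow>\<^sub>L 'h"
  assumes "hilbert_schmidt A"
  shows "hilbert_schmidt (- A)"
  using assms unfolding hilbert_schmidt_basis by (simp add: blinfun.minus_left)

lemma hilbert_schmidt_diff:
  fixes A :: "'h::{real_inner,banach,second_countable_topology} \<Rightarrow>\<^sub>L 'h"
  assumes "hilbert_schmidt A" "hilbert_schmidt A'"
  shows "hilbert_schmidt (A - A')"
  using hilbert_schmidt_add[OF assms(1) hilbert_schmidt_uminus[OF assms(2)]] by simp

lemma hs_summable_inner:
  fixes A :: "'h::{real_inner,banach,second_countable_topology} \<Rightarrow>\<^sub>L 'h"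
  assumes "hilbert_schmidt A" "hilbert_schmidt A'"
  shows "(\<lambda>e. A e \<bullet> A' e) summable_on hs_basis"
proof -
  have "(\<lambda>e. (norm (A e + A' e))\<^sup>2) summable_on hs_basis"
       "(\<lambda>e. (norm (A e - A' e))\<^sup>2) summable_on hs_basis"
    using hilbert_schmidt_add[OF assms] hilbert_schmidt_diff[OF assms]
    unfolding hilbert_schmidt_basis by (simp_all add: blinfun.add_left blinfun.diff_left)
  then have "(\<lambda>e. (1/4) * ((norm (A e + A' e))\<^sup>2 + (- (norm (A e - A' e))\<^sup>2))) summable_on hs_basis"
    by (intro summable_on_cmult_right summable_on_add) (auto simp: summable_on_uminus)
  moreover have "(1/4) * ((norm (A e + A' e))\<^sup>2 + (- (norm (A e - A' e))\<^sup>2)) = A e \<bullet> A' e" for e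
    by (simp add: power2_norm_eq_inner inner_add inner_diff inner_commute algebra_simps)
  ultimately show ?thesis by simp
qed

lemma hs_norm_le:
  fixes A :: "'h::{real_inner,banach,second_countable_topology} \<Rightarrow>\<^sub>L 'h"
  assumes "hilbert_schmidt A"
  shows "norm A \<le> sqrt (\<Sum>\<^sub>\<infinity>e\<in>hs_basis. A e \<bullet> A e)"
proof (rule norm_blinfun_bound)
  define S where "S = (\<Sum>\<^sub>\<infinity>e\<in>hs_basis. A e \<bullet> A e)"
  have S0: "S \<ge> 0" unfolding S_def by (rule infsum_nonneg) simp
  then show "0 \<le> sqrt (\<Sum>\<^sub>\<infinity>e\<in>hs_basis. A e \<bullet> A e)" by (simp add: S_def)
  fix x
  define y where "y = A x"
  have "((\<lambda>e. (A e \<bullet> y)\<^sup>2) has_sum (norm (coord_functional A y))\<^sup>2) hs_basis"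
    using functional_has_sum_norm[OF hs_basis(2), of "coord_functional A y"] by simp
  moreover have "((\<lambda>e. (A e \<bullet> A e) * (norm y)\<^sup>2) has_sum S * (norm y)\<^sup>2) hs_basis"
    unfolding S_def by (intro has_sum_cmult_left has_sum_infsum hs_summable_inner assms)
  moreover have "(A e \<bullet> y)\<^sup>2 \<le> (A e \<bullet> A e) * (norm y)\<^sup>2" for e
    using Cauchy_Schwarz_ineq[of "A e" y] by (simp add: power2_norm_eq_inner)
  ultimately have "(norm (coord_functional A y))\<^sup>2 \<le> S * (norm y)\<^sup>2"
    by (rule has_sum_mono)
  then have "norm (coord_functional A y) \<le> sqrt S * norm y"
    by (metis norm_ge_zero real_le_rsqrt real_sqrt_mult real_sqrt_pow2 real_sqrt_power)
  moreover have "(norm y)\<^sup>2 \<le> norm (coord_functional A y) * norm x"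
    using norm_blinfun[of "coord_functional A y" x] by (simp add: y_def power2_norm_eq_inner)
  ultimately have "(norm y)\<^sup>2 \<le> (sqrt S * norm y) * norm x"
    by (meson mult_right_mono norm_ge_zero order_trans)
  then have "norm y * norm y \<le> (sqrt S * norm x) * norm y" by (simp add: power2_eq_square algebra_simps)
  then have "norm y \<le> sqrt S * norm x"
    using S0 by (cases "y = 0") auto
  then show "norm (A x) \<le> sqrt (\<Sum>\<^sub>\<infinity>e\<in>hs_basis. A e \<bullet> A e) * norm x"
    by (simp add: y_def S_def)
qed

instantiation hs_op :: ("{real_inner,banach,second_countable_topology}") real_inner
begin

lift_definition zero_hs_op :: "'a hs_op" is 0 by (simp add: hilbert_schmidt_basis)
lift_definition plus_hs_op :: "'a hs_op \<Rightarrow> 'a hs_op \<Rightarrow> 'a hs_op" is "(+)"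
  by (rule hilbert_schmidt_add)
lift_definition uminus_hs_op :: "'a hs_op \<Rightarrow> 'a hs_op" is uminus
  by (rule hilbert_schmidt_uminus)
lift_definition minus_hs_op :: "'a hs_op \<Rightarrow> 'a hs_op \<Rightarrow> 'a hs_op" is "(-)"
  by (rule hilbert_schmidt_diff)
lift_definition scaleR_hs_op :: "real \<Rightarrow> 'a hs_op \<Rightarrow> 'a hs_op" is "scaleR"
  by (rule hilbert_schmidt_scaleR)

lift_definition inner_hs_op :: "'a hs_op \<Rightarrow> 'a hs_op \<Rightarrow> real" is
  "\<lambda>A A'. \<Sum>\<^sub>\<infinity>e\<in>hs_basis. blinfun_apply A e \<bullet> blinfun_apply A' e" .

definition "norm A = sqrt (A \<bullet> A)" for A :: "'a hs_op"
definition "dist A A' = norm (A - A')" for A A' :: "'a hs_op"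
definition "sgn A = scaleR (inverse (norm A)) A" for A :: "'a hs_op"
definition [code del]: "(uniformity :: ('a hs_op \<times> 'a hs_op) filter) =
  (INF e\<in>{0<..}. principal {(x, y). dist x y < e})"
definition [code del]: "open (U :: 'a hs_op set) \<longleftrightarrow>
  (\<forall>x\<in>U. \<forall>\<^sub>F (x', y) in uniformity. x' = x \<longrightarrow> y \<in> U)"

instance
proof
  fix A A' A'' :: "'a hs_op" and r s :: real
  show "A + A' + A'' = A + (A' + A'')" "A + A' = A' + A" "0 + A = A" "- A + A = 0"
    "A - A' = A + - A'" "r *\<^sub>R (A + A') = r *\<^sub>R A + r *\<^sub>R A'" "(r + s) *\<^sub>R A = r *\<^sub>R A + s *\<^sub>R A"
    "r *\<^sub>R s *\<^sub>R A = (r * s) *\<^sub>R A" "1 *\<^sub>R A = A"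
    by (transfer, simp add: algebra_simps)+
  show "dist A A' = norm (A - A')" "sgn A = scaleR (inverse (norm A)) A" "norm A = sqrt (A \<bullet> A)"
    by (simp_all add: dist_hs_op_def sgn_hs_op_def norm_hs_op_def)
  show "(uniformity :: ('a hs_op \<times> 'a hs_op) filter) = (INF e\<in>{0<..}. principal {(x, y). dist x y < e})"
    by (fact uniformity_hs_op_def)
  show "open U \<longleftrightarrow> (\<forall>x\<in>U. \<forall>\<^sub>F (x', y) in uniformity. x' = x \<longrightarrow> y \<in> U)" for U :: "'a hs_op set"
    by (fact open_hs_op_def)
  show "A \<bullet> A' = A' \<bullet> A" by transfer (simp add: inner_commute)
  show "(A + A') \<bullet> A'' = A \<bullet> A'' + A' \<bullet> A''"
    by transfer (simp add: blinfun.add_left inner_add_left infsum_add hs_summable_inner)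
  show "(r *\<^sub>R A) \<bullet> A' = r * (A \<bullet> A')"
    by transfer (simp add: blinfun.scaleR_left infsum_cmult_right hs_summable_inner)
  show "0 \<le> A \<bullet> A" by transfer (simp add: infsum_nonneg)
  show "A \<bullet> A = 0 \<longleftrightarrow> A = 0"
  proof transfer
    fix A :: "'a \<Rightarrow>\<^sub>L 'a" assume "hilbert_schmidt A"
    from hs_norm_le[OF this] show "(\<Sum>\<^sub>\<infinity>e\<in>hs_basis. A e \<bullet> A e) = 0 \<longleftrightarrow> A = 0" by auto
  qed
qed

end

lemma norm_hs_op_eq:
  assumes "orthonormal_basis B"
  shows "(norm A)\<^sup>2 = (\<Sum>\<^sub>\<infinity>e\<in>B. (norm (blinfun_of_hs A e))\<^sup>2)"
proof -
  have hs: "hilbert_schmidt (blinfun_of_hs A)" using blinfun_of_hs by blast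
  have "((\<lambda>e. (norm (blinfun_of_hs A e))\<^sup>2) has_sum (norm A)\<^sup>2) hs_basis"
    using hs_summable_inner[OF hs hs]
    by (simp add: has_sum_iff power2_norm_eq_inner inner_hs_op.rep_eq)
  from has_sum_basis_indep[OF hs_basis(2) assms this] show ?thesis
    by (simp add: infsumI)
qed

lemma hilbert_schmidt_blinfun_of_hs [simp]: "hilbert_schmidt (blinfun_of_hs A)"
  using blinfun_of_hs by blast

lemma norm_blinfun_of_hs_le: "norm (blinfun_of_hs A) \<le> norm A"
  using hs_norm_le[of "blinfun_of_hs A"] by (simp add: norm_hs_op_def inner_hs_op.rep_eq)

lemma hs_finite_sum_le:
  assumes "finite F" "F \<subseteq> hs_basis"
  shows "(\<Sum>e\<in>F. (norm (blinfun_of_hs A e))\<^sup>2) \<le> (norm A)\<^sup>2"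
  unfolding norm_hs_op_eq[OF hs_basis(2)]
  by (rule finite_sum_le_infsum)
    (use assms hilbert_schmidt_blinfun_of_hs[of A] in \<open>auto simp: hilbert_schmidt_basis\<close>)

lemma hs_boundedI:
  assumes "\<And>F. finite F \<Longrightarrow> F \<subseteq> hs_basis \<Longrightarrow> (\<Sum>e\<in>F. (norm (blinfun_apply A e))\<^sup>2) \<le> c"
  shows "hilbert_schmidt A" "(norm (Abs_hs A))\<^sup>2 \<le> c"
proof -
  have s: "(\<lambda>e. (norm (A e))\<^sup>2) summable_on hs_basis"
    by (rule nonneg_bdd_above_summable_on) (auto intro!: bdd_aboveI[of _ c] assms)
  then show h: "hilbert_schmidt A" by (simp add: hilbert_schmidt_basis)
  show "(norm (Abs_hs A))\<^sup>2 \<le> c"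
    unfolding norm_hs_op_eq[OF hs_basis(2)] using h
    by (auto simp: Abs_hs_inverse intro!: infsum_le_finite_sums s assms)
qed

instance hs_op :: ("{real_inner,banach,second_countable_topology}") banach
proof
  fix X :: "nat \<Rightarrow> 'a hs_op" assume X: "Cauchy X"
  have "Cauchy (\<lambda>n. blinfun_of_hs (X n))"
  proof (rule metric_CauchyI)
    fix e :: real assume "0 < e"
    with X obtain M where M: "\<And>m n. m \<ge> M \<Longrightarrow> n \<ge> M \<Longrightarrow> dist (X m) (X n) < e"
      unfolding Cauchy_def by blast
    have "dist (blinfun_of_hs (X m)) (blinfun_of_hs (X n)) \<le> dist (X m) (X n)" for m n
      using norm_blinfun_of_hs_le[of "X m - X n"] by (simp add: dist_norm minus_hs_op.rep_eq)
    then show "\<exists>M. \<forall>m\<ge>M. \<forall>n\<ge>M. dist (blinfun_of_hs (X m)) (blinfun_of_hs (X n)) < e"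
      using M by (meson order_le_less_trans)
  qed
  then obtain A where A: "(\<lambda>n. blinfun_of_hs (X n)) \<longlonglongrightarrow> A"
    using Cauchy_convergent convergent_def by blast
  have key: "\<exists>M. \<forall>n\<ge>M. \<forall>F. finite F \<longrightarrow> F \<subseteq> hs_basis \<longrightarrow>
      (\<Sum>e\<in>F. (norm ((blinfun_of_hs (X n) - A) e))\<^sup>2) \<le> \<epsilon>\<^sup>2" if "\<epsilon> > 0" for \<epsilon>
  proof -
    from X that obtain M where M: "\<And>m n. m \<ge> M \<Longrightarrow> n \<ge> M \<Longrightarrow> dist (X m) (X n) < \<epsilon>"
      unfolding Cauchy_def by blast
    show ?thesis
    proof (intro exI[of _ M] allI impI)
      fix n F assume n: "M \<le> n" and F: "finite F" "F \<subseteq> (hs_basis :: 'a set)"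
      have lim: "(\<lambda>m. \<Sum>e\<in>F. (norm ((blinfun_of_hs (X n) - blinfun_of_hs (X m)) e))\<^sup>2)
          \<longlonglongrightarrow> (\<Sum>e\<in>F. (norm ((blinfun_of_hs (X n) - A) e))\<^sup>2)"
        by (intro tendsto_intros A)
      have "(\<Sum>e\<in>F. (norm ((blinfun_of_hs (X n) - blinfun_of_hs (X m)) e))\<^sup>2) \<le> \<epsilon>\<^sup>2" if "m \<ge> M" for m
      proof -
        have "(\<Sum>e\<in>F. (norm ((blinfun_of_hs (X n) - blinfun_of_hs (X m)) e))\<^sup>2) \<le> (norm (X n - X m))\<^sup>2"
          using hs_finite_sum_le[OF F, of "X n - X m"] by (simp add: minus_hs_op.rep_eq)
        also have "\<dots> \<le> \<epsilon>\<^sup>2"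
          using M[OF n that] by (intro power_mono) (auto simp: dist_norm)
        finally show ?thesis .
      qed
      then show "(\<Sum>e\<in>F. (norm ((blinfun_of_hs (X n) - A) e))\<^sup>2) \<le> \<epsilon>\<^sup>2"
        by (intro LIMSEQ_le_const2[OF lim]) blast
    qed
  qed
  have hsA: "hilbert_schmidt A"
  proof -
    obtain M where "\<And>F. finite F \<Longrightarrow> F \<subseteq> hs_basis \<Longrightarrow>
      (\<Sum>e\<in>F. (norm ((blinfun_of_hs (X M) - A) e))\<^sup>2) \<le> 1\<^sup>2"
      using key[of 1] by auto
    then have "hilbert_schmidt (blinfun_of_hs (X M) - A)" by (rule hs_boundedI)
    from hilbert_schmidt_diff[OF hilbert_schmidt_blinfun_of_hs[of "X M"] this] show ?thesis by simp
  qed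
  have "X \<longlonglongrightarrow> Abs_hs A"
  proof (rule metric_LIMSEQ_I)
    fix r :: real assume "r > 0"
    then obtain M where M: "\<And>n F. M \<le> n \<Longrightarrow> finite F \<Longrightarrow> F \<subseteq> hs_basis \<Longrightarrow>
      (\<Sum>e\<in>F. (norm ((blinfun_of_hs (X n) - A) e))\<^sup>2) \<le> (r/2)\<^sup>2"
      using key[of "r/2"] by auto
    have "dist (X n) (Abs_hs A) < r" if "n \<ge> M" for n
    proof -
      have "Abs_hs (blinfun_of_hs (X n) - A) = X n - Abs_hs A"
        by (metis Abs_hs_inverse blinfun_of_hs_inverse hsA mem_Collect_eq minus_hs_op.rep_eq)
      then have "(norm (X n - Abs_hs A))\<^sup>2 \<le> (r/2)\<^sup>2"
        using hs_boundedI(2)[OF M[OF that]] by metis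
      then have "norm (X n - Abs_hs A) \<le> r/2"
        using \<open>r > 0\<close> by (simp add: power2_le_iff_abs_le)
      then show ?thesis using \<open>r > 0\<close> by (simp add: dist_norm)
    qed
    then show "\<exists>M. \<forall>n\<ge>M. dist (X n) (Abs_hs A) < r" by blast
  qed
  then show "convergent X" by (auto simp: convergent_def)
qed

lemma hs_countable_dense:
  "\<exists>E :: 'h::{real_inner,banach,second_countable_topology} hs_op set.
     countable E \<and> (\<forall>A. \<forall>r>0. \<exists>A'\<in>E. dist A A' < r)"
proof -
  obtain D :: "'h set" where D: "countable D" "\<And>X. open X \<Longrightarrow> X \<noteq> {} \<Longrightarrow> \<exists>d\<in>D. d \<in> X"
    by (rule countable_dense_setE) blast
  define op :: "('h \<times> 'h) set \<Rightarrow> 'h \<Rightarrow>\<^sub>L 'h" where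
    "op P = (\<Sum>(e, d)\<in>P. blinfun_scaleR_left d o\<^sub>L blinfun_inner_left e)" for P
  define E where "E = (\<lambda>P. Abs_hs (op P)) ` {P. P \<subseteq> hs_basis \<times> D \<and> finite P}"
  have "countable E"
    unfolding E_def using D(1) hs_basis(1)
    by (subst conj_commute) (intro countable_image countable_Collect_finite_subset countable_SIGMA)
  moreover have "\<exists>A'\<in>E. dist A A' < r" if "r > 0" for A r
  proof -
    let ?a = "blinfun_of_hs A"
    let ?B = "hs_basis :: 'h set"
    have sum_A: "(\<lambda>e. (norm (?a e))\<^sup>2) summable_on ?B"
      using hilbert_schmidt_blinfun_of_hs[of A] by (simp add: hilbert_schmidt_basis)
    obtain F where F: "finite F" "F \<subseteq> ?B"
      and tail: "dist (\<Sum>e\<in>F. (norm (?a e))\<^sup>2) (\<Sum>\<^sub>\<infinity>e\<in>?B. (norm (?a e))\<^sup>2) \<le> r\<^sup>2 / 4"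
      using infsum_finite_approximation[OF sum_A, of "r\<^sup>2 / 4"] \<open>r > 0\<close> by auto
    define \<delta> where "\<delta> = sqrt (r\<^sup>2 / (4 * (real (card F) + 1)))"
    have \<delta>: "\<delta> > 0" "\<delta>\<^sup>2 = r\<^sup>2 / (4 * (real (card F) + 1))" using \<open>r > 0\<close> by (auto simp: \<delta>_def)
    have "\<exists>d\<in>D. dist (?a e) d < \<delta>" for e
      using D(2)[of "ball (?a e) \<delta>"] \<delta> by auto
    then obtain d where d: "\<And>e. d e \<in> D" "\<And>e. dist (?a e) (d e) < \<delta>" by metis
    define P where "P = (\<lambda>e. (e, d e)) ` F"
    have opP: "op P x = (\<Sum>e\<in>F. (x \<bullet> e) *\<^sub>R d e)" for x
      unfolding op_def P_def
      by (subst sum.reindex) (auto simp: inj_on_def blinfun.sum_left)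
    have onb: "e \<bullet> f = (if e = f then 1 else 0)" if "e \<in> ?B" "f \<in> ?B" for e f
      using hs_basis(2) that
      by (auto simp: orthonormal_basis_def pairwise_def orthogonal_def dot_square_norm)
    have opP': "op P e = (if e \<in> F then d e else 0)" if "e \<in> ?B" for e
    proof -
      have "op P e = (\<Sum>f\<in>F. if e = f then d e else 0)"
        unfolding opP using onb that F by (intro sum.cong) auto
      then show ?thesis using F(1) by simp
    qed
    have bound: "(\<Sum>e\<in>G. (norm ((?a - op P) e))\<^sup>2) \<le> r\<^sup>2 / 2" if G: "finite G" "G \<subseteq> ?B" for G
    proof -
      have "(\<Sum>e\<in>G. (norm ((?a - op P) e))\<^sup>2)
          = (\<Sum>e\<in>G \<inter> F. (norm (?a e - d e))\<^sup>2) + (\<Sum>e\<in>G - F. (norm (?a e))\<^sup>2)"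
        using G F
        by (subst sum.Int_Diff[of G _ F]) (auto simp: blinfun.diff_left opP' intro!: arg_cong2[where f="(+)"] sum.cong)
      also have "(\<Sum>e\<in>G \<inter> F. (norm (?a e - d e))\<^sup>2) \<le> (\<Sum>e\<in>G \<inter> F. \<delta>\<^sup>2)"
        using d(2) by (intro sum_mono power_mono) (auto simp: dist_norm less_imp_le)
      also have "\<dots> \<le> (real (card F) + 1) * \<delta>\<^sup>2"
        using card_mono[of F "G \<inter> F"] F(1) by (simp add: mult_right_mono)
      also have "\<dots> = r\<^sup>2 / 4" by (simp add: \<delta>(2) field_simps add_pos_nonneg)
      also have "(\<Sum>e\<in>G - F. (norm (?a e))\<^sup>2) \<le> r\<^sup>2 / 4"
      proof -
        have "(\<Sum>e\<in>G - F. (norm (?a e))\<^sup>2) + (\<Sum>e\<in>F. (norm (?a e))\<^sup>2) = (\<Sum>e\<in>(G - F) \<union> F. (norm (?a e))\<^sup>2)"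
          using G F by (intro sum.union_disjoint[symmetric]) auto
        also have "\<dots> \<le> (\<Sum>\<^sub>\<infinity>e\<in>?B. (norm (?a e))\<^sup>2)"
          using G F by (intro finite_sum_le_infsum sum_A) auto
        finally show ?thesis using tail unfolding dist_real_def by linarith
      qed
      finally show ?thesis by simp
    qed
    have "hilbert_schmidt (?a - op P)" by (rule hs_boundedI(1)[OF bound])
    from hilbert_schmidt_diff[OF hilbert_schmidt_blinfun_of_hs[of A] this]
    have "hilbert_schmidt (op P)" by simp
    then have "Abs_hs (?a - op P) = A - Abs_hs (op P)"
      by (metis Abs_hs_inverse blinfun_of_hs_inverse mem_Collect_eq minus_hs_op.rep_eq)
    then have "(norm (A - Abs_hs (op P)))\<^sup>2 \<le> r\<^sup>2 / 2" using hs_boundedI(2)[OF bound] by metis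
    also have "\<dots> < r\<^sup>2" using \<open>r > 0\<close> by simp
    finally have "norm (A - Abs_hs (op P)) < r" using \<open>r > 0\<close> by (simp add: power_less_imp_less_base)
    moreover have "Abs_hs (op P) \<in> E"
      unfolding E_def P_def using d(1) F by auto
    ultimately show ?thesis by (auto simp: dist_norm)
  qed
  ultimately show ?thesis by blast
qed

instance hs_op :: ("{real_inner,banach,second_countable_topology}") second_countable_topology
proof
  obtain E :: "'a hs_op set" where E: "countable E" "\<And>A r. r > 0 \<Longrightarrow> \<exists>A'\<in>E. dist A A' < r"
    using hs_countable_dense by blast
  define \<B> where "\<B> = (\<lambda>(A, n). ball A (1 / real (Suc n))) ` (E \<times> (UNIV :: nat set))"
  have "countable \<B>" unfolding \<B>_def using E(1) by auto
  moreover have "topological_basis \<B>"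
  proof (rule topological_basisI)
    fix U assume "U \<in> \<B>"
    then show "open U" by (auto simp: \<B>_def)
  next
    fix U and A :: "'a hs_op" assume "open U" "A \<in> U"
    then obtain r where r: "r > 0" "ball A r \<subseteq> U" using open_contains_ball by blast
    obtain n where n: "1 / real (Suc n) < r / 2"
      using r(1) nat_approx_posE[of "r/2"] by auto
    obtain A' where A': "A' \<in> E" "dist A A' < 1 / real (Suc n)" using E(2)[of "1 / real (Suc n)"] by auto
    have "ball A' (1 / real (Suc n)) \<subseteq> ball A r"
    proof
      fix x assume "x \<in> ball A' (1 / real (Suc n))"
      then show "x \<in> ball A r" using A'(2) n dist_triangle[of A x A'] by simp
    qed
    then show "\<exists>B'\<in>\<B>. A \<in> B' \<and> B' \<subseteq> U"
      using A' r(2) by (intro bexI[of _ "ball A' (1 / real (Suc n))"]) (auto simp: \<B>_def dist_commute)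
  qed
  ultimately show "\<exists>B :: 'a hs_op set set. countable B \<and> open = generate_topology B"
    using topological_basis_imp_subbasis by blast
qed

section \<open>Compound Poisson processes and linear stochastic equations\<close>

text \<open>Increments are taken in \<open>int\<close> because subtraction on \<open>nat\<close> truncates.\<close>

definition (in prob_space) poisson_process :: "real \<Rightarrow> (real \<Rightarrow> 'a \<Rightarrow> nat) \<Rightarrow> bool" where
  "poisson_process lam N \<longleftrightarrow>
     (\<forall>t\<ge>0. N t \<in> M \<rightarrow>\<^sub>M count_space UNIV) \<and>
     (AE \<omega> in M. N 0 \<omega> = 0) \<and>
     (\<forall>s t k. 0 \<le> s \<and> s \<le> t \<longrightarrow>
        \<P>(\<omega> in M. N t \<omega> = N s \<omega> + k) = exp (- (lam * (t - s))) * (lam * (t - s)) ^ k / fact k) \<and>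
     (\<forall>t n. 0 \<le> t 0 \<and> (\<forall>i<n. t i \<le> t (Suc i)) \<longrightarrow>
        indep_vars (\<lambda>_. count_space UNIV)
          (\<lambda>i \<omega>. int (N (t (Suc i)) \<omega>) - int (N (t i) \<omega>)) {..<n}) \<and>
     (AE \<omega> in M. \<forall>t\<ge>0. continuous (at_right t) (\<lambda>s. real (N s \<omega>)) \<and>
        (t > 0 \<longrightarrow> (\<exists>l. ((\<lambda>s. real (N s \<omega>)) \<longlongrightarrow> l) (at_left t))))"

definition (in prob_space) iid_sequence :: "(nat \<Rightarrow> 'a \<Rightarrow> 'b::topological_space) \<Rightarrow> bool" where
  "iid_sequence X \<longleftrightarrow>
     indep_vars (\<lambda>_. borel) X {1..} \<and> (\<forall>i\<ge>1. distr M borel (X i) = distr M borel (X 1))"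

text \<open>Independence of the \<open>\<sigma>\<close>-algebras generated by the whole path of \<open>N\<close> and by the whole sequence
  \<open>X\<close>; \<open>indep_var\<close> does not apply, since it requires both variables to have the same value type.\<close>

definition (in prob_space) indep_of_process ::
    "(real \<Rightarrow> 'a \<Rightarrow> nat) \<Rightarrow> (nat \<Rightarrow> 'a \<Rightarrow> 'b::topological_space) \<Rightarrow> bool" where
  "indep_of_process N X \<longleftrightarrow>
     indep_set
       (sets (vimage_algebra (space M) (\<lambda>\<omega>. \<lambda>t\<in>{0..}. N t \<omega>) (Pi\<^sub>M {0..} (\<lambda>_. count_space UNIV))))
       (sets (vimage_algebra (space M) (\<lambda>\<omega>. \<lambda>i\<in>{1..}. X i \<omega>) (Pi\<^sub>M {1..} (\<lambda>_. borel))))"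

definition (in prob_space) compound_poisson ::
    "real \<Rightarrow> (real \<Rightarrow> 'a \<Rightarrow> nat) \<Rightarrow> (nat \<Rightarrow> 'a \<Rightarrow> 'b::{banach,second_countable_topology}) \<Rightarrow>
      (real \<Rightarrow> 'a \<Rightarrow> 'b) \<Rightarrow> bool" where
  "compound_poisson lam N X L \<longleftrightarrow>
     0 < lam \<and> poisson_process lam N \<and> iid_sequence X \<and> indep_of_process N X \<and>
     (\<forall>t\<ge>0. \<forall>\<omega>\<in>space M. L t \<omega> = (\<Sum>i=1..N t \<omega>. X i \<omega>))"

definition (in prob_space) square_integrable_process ::
    "(real \<Rightarrow> 'a \<Rightarrow> 'b::{banach,second_countable_topology}) \<Rightarrow> bool" where
  "square_integrable_process L \<longleftrightarrow>
     (\<forall>t\<ge>0. L t \<in> borel_measurable M \<and> integrable M (\<lambda>\<omega>. (norm (L t \<omega>))\<^sup>2))"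

text \<open>The equation \<open>dV = C V dt + dL\<close>, \<open>V(0) = V0\<close>, in its integrated form with a pathwise Bochner
  integral; the noise is additive, so no stochastic integral is involved.\<close>

definition (in prob_space) solves_linear_sde ::
    "('b::{banach,second_countable_topology} \<Rightarrow>\<^sub>L 'b) \<Rightarrow> ('a \<Rightarrow> 'b) \<Rightarrow> (real \<Rightarrow> 'a \<Rightarrow> 'b) \<Rightarrow>
      (real \<Rightarrow> 'a \<Rightarrow> 'b) \<Rightarrow> bool" where
  "solves_linear_sde C V0 L V \<longleftrightarrow>
     (\<forall>t\<ge>0. V t \<in> borel_measurable M) \<and>
     (AE \<omega> in M. \<forall>t\<ge>0.
        set_integrable lborel {0..t} (\<lambda>s. C (V s \<omega>)) \<and>
        V t \<omega> = V0 \<omega> + (LBINT s:{0..t}. C (V s \<omega>)) + L t \<omega>)"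

end

theory Submission
  imports Defs
begin

text \<open>The difference of the two solutions is estimated path by path, and the resulting bound is then
  integrated.

  Fix a path and put \<open>S = (\<Sum>i=1..N T. norm (X i))\<close>, the sum of the norms of the jumps up to \<open>T\<close>.
  Almost surely \<open>N t \<le> N T\<close>, hence \<open>norm (L t) \<le> S\<close>, for all \<open>t \<le> T\<close> (\<open>poisson_process_AE_path_le\<close>). The
  noise is additive and common to both equations, so it cancels in \<open>V t - Vn n t\<close>, and
  two applications of Gronwall's inequality give, with \<open>m = max (norm C) (norm (Cn n))\<close>,
  \<open>norm (V t - Vn n t) \<le> T * exp (m T) * norm (C - Cn n) * (norm V0 + S)\<close>
  (\<open>linear_equation_perturbation\<close>). This is the bound given by the variation-of-constants formula,
  but it is derived from the integral equations alone, without operator exponentials or jump times.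

  Squaring and separating \<open>V0\<close> from \<open>S\<close> costs a factor 2. The expectation of \<open>S\<^sup>2\<close> is computed exactly
  by conditioning on \<open>N T\<close> (\<open>compound_poisson_jump_norms_second_moment\<close>); it equals
  \<open>lam T E[norm (X 1)\<^sup>2] + (lam T)\<^sup>2 (E[norm (X 1)])\<^sup>2\<close>, which supplies the last two terms of the
  constant.\<close>

section \<open>Gronwall estimates for linear integral equations\<close>

text \<open>Gronwall's inequality, with the comparison function read off from \<open>u' = m u + b exp (m t)\<close>,
  \<open>u(0) = a\<close>, whose solution is \<open>(a + b t) exp (m t)\<close>. Both uses below are special cases: \<open>b = 0\<close>
  bounds the growth of one solution, \<open>a = 0\<close> the distance of two. A coarser bound for the
  exponential forcing would lose the constant of the theorem.\<close>

lemma gronwall_exp_forcing: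
  fixes \<psi> :: "real \<Rightarrow> real"
  assumes cont: "continuous_on {0..T} \<psi>" and m: "0 \<le> m"
    and le: "\<And>t. t \<in> {0..T} \<Longrightarrow> \<psi> t \<le> a + integral {0..t} (\<lambda>s. b * exp (m * s) + m * \<psi> s)"
    and t: "t \<in> {0..T}"
  shows "\<psi> t \<le> (a + b * t) * exp (m * t)"
proof -
  define u where "u t = a + integral {0..t} (\<lambda>s. b * exp (m * s) + m * \<psi> s)" for t
  define G where "G t = u t * exp (- (m * t)) - b * t" for t
  have du: "(u has_real_derivative b * exp (m * s) + m * \<psi> s) (at s within {0..T})"
    if "s \<in> {0..T}" for s
  proof -
    have "((\<lambda>t. integral {0..t} (\<lambda>s. b * exp (m * s) + m * \<psi> s))
        has_real_derivative b * exp (m * s) + m * \<psi> s) (at s within {0..T})"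
      by (rule integral_has_real_derivative) (intro continuous_intros cont that)+
    from DERIV_add[OF DERIV_const this] show ?thesis unfolding u_def by simp
  qed
  have dG: "(G has_real_derivative m * (\<psi> s - u s) * exp (- (m * s))) (at s within {0..T})"
    if "s \<in> {0..T}" for s
    unfolding G_def
    by (rule derivative_eq_intros du[OF that] refl)+
      (simp add: algebra_simps flip: exp_add)
  \<comment> \<open>\<open>G\<close> is constant when the integral inequality is an equality.\<close>
  have "G t \<le> G 0"
  proof (rule DERIV_nonpos_imp_decreasing_open[where f = G])
    fix s assume s: "0 < s" "s < t"
    then have "at s within {0..T} = at s" using t by (intro at_within_Icc_at) auto
    moreover have "m * (\<psi> s - u s) * exp (- (m * s)) \<le> 0"
      using le[of s] s t m by (auto simp: u_def mult_le_0_iff)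
    ultimately show "\<exists>y. (G has_real_derivative y) (at s) \<and> y \<le> 0"
      using dG[of s] s t by auto
  next
    have "continuous_on {0..T} G"
      unfolding continuous_on_eq_continuous_within using dG DERIV_continuous by blast
    then show "continuous_on {0..t} G" by (rule continuous_on_subset) (use t in auto)
  qed (use t in auto)
  then have "u t * exp (- (m * t)) \<le> a + b * t" by (simp add: G_def u_def)
  then have "u t * exp (- (m * t)) * exp (m * t) \<le> (a + b * t) * exp (m * t)"
    by (rule mult_right_mono) simp
  also have "u t * exp (- (m * t)) * exp (m * t) = u t" by (simp add: mult.assoc flip: exp_add)
  finally show ?thesis using le[OF t] by (simp add: u_def)
qed

text \<open>The unknown is the integrand itself. Its integral is continuous even though \<open>f\<close> is only
  integrable, so the continuous version applies; for a linear equation with jumps, \<open>f\<close> is the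
  drift along a discontinuous path.\<close>

lemma gronwall_norm_integral:
  fixes f :: "real \<Rightarrow> 'b::{banach,second_countable_topology}"
  assumes int: "set_integrable lborel {0..T} f" and m: "0 \<le> m"
    and bound: "\<And>s. s \<in> {0..T} \<Longrightarrow>
      norm (f s) \<le> b * exp (m * s) + m * (a + (LBINT r:{0..s}. norm (f r)))"
    and t: "t \<in> {0..T}"
  shows "a + (LBINT r:{0..t}. norm (f r)) \<le> (a + b * t) * exp (m * t)"
proof (rule gronwall_exp_forcing[OF _ m _ t])
  have sub: "set_integrable lborel {0..s} (\<lambda>r. norm (f r))" if "s \<in> {0..T}" for s
    using set_integrable_subset[OF set_integrable_norm[OF int], of "{0..s}"] that by simp
  have eq: "(LBINT r:{0..s}. norm (f r)) = integral {0..s} (\<lambda>r. norm (f r))" if "s \<in> {0..T}" for s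
    using set_borel_integral_eq_integral(2)[OF sub[OF that]] .
  have "T \<in> {0..T}" using t by auto
  have "continuous_on {0..T} (\<lambda>s. integral {0..s} (\<lambda>r. norm (f r)))"
    by (rule indefinite_integral_continuous_1)
      (rule set_borel_integral_eq_integral(1)[OF sub[OF \<open>T \<in> {0..T}\<close>]])
  then have "continuous_on {0..T} (\<lambda>s. LBINT r:{0..s}. norm (f r))"
    by (subst continuous_on_cong[OF refl eq])
  then show cont: "continuous_on {0..T} (\<lambda>s. a + (LBINT r:{0..s}. norm (f r)))"
    by (intro continuous_intros)
  let ?g = "\<lambda>s. b * exp (m * s) + m * (a + (LBINT r:{0..s}. norm (f r)))"
  fix s assume s: "s \<in> {0..T}"
  have "continuous_on {0..s} ?g"
    by (intro continuous_intros continuous_on_subset[OF cont]) (use s in auto)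
  then have g: "set_integrable lborel {0..s} ?g" by (rule borel_integrable_atLeastAtMost')
  have "(LBINT r:{0..s}. norm (f r)) \<le> (LBINT r:{0..s}. ?g r)"
    by (rule set_integral_mono[OF sub[OF s] g]) (use bound s in auto)
  then show "a + (LBINT r:{0..s}. norm (f r)) \<le> a + integral {0..s} ?g"
    using set_borel_integral_eq_integral(2)[OF g] by simp
qed

text \<open>With the same forcing \<open>l\<close>, the difference satisfies
  \<open>v t - w t = (LBINT s:{0..t}. (C - D) (v s) + D (v s - w s))\<close>. The growth bound
  \<open>norm (v s) \<le> (norm x + S) * exp (m s)\<close>, where \<open>m\<close> is the larger of the two operator norms, turns
  the first term into an exponential forcing, and Gronwall's inequality for the second term
  yields the extra factor \<open>t\<close>. The same estimate would follow from
  \<open>norm (exp (t C) - exp (t D)) \<le> t exp (m t) norm (C - D)\<close> and the explicit solution, but here the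
  jumps enter only through the uniform bound \<open>S\<close>.\<close>

lemma linear_equation_perturbation:
  fixes C D :: "'b::{banach,second_countable_topology} \<Rightarrow>\<^sub>L 'b" and v w l :: "real \<Rightarrow> 'b"
  assumes intv: "\<And>t. t \<in> {0..T} \<Longrightarrow> set_integrable lborel {0..t} (\<lambda>s. C (v s))"
    and v: "\<And>t. t \<in> {0..T} \<Longrightarrow> v t = x + (LBINT s:{0..t}. C (v s)) + l t"
    and intw: "\<And>t. t \<in> {0..T} \<Longrightarrow> set_integrable lborel {0..t} (\<lambda>s. D (w s))"
    and w: "\<And>t. t \<in> {0..T} \<Longrightarrow> w t = x + (LBINT s:{0..t}. D (w s)) + l t"
    and l: "\<And>t. t \<in> {0..T} \<Longrightarrow> norm (l t) \<le> S"
    and t: "t \<in> {0..T}"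
  shows "norm (v t - w t) \<le> T * exp (T * max (norm C) (norm D)) * (norm x + S) * norm (C - D)"
proof -
  define m where "m = max (norm C) (norm D)"
  define R where "R = norm x + S"
  define K where "K = norm (C - D) * R"
  let ?f = "\<lambda>s. C (v s)" and ?g = "\<lambda>s. C (v s) - D (w s)"
  have T: "T \<in> {0..T}" and m: "0 \<le> m" "norm C \<le> m" "norm D \<le> m"
    using t by (auto simp: m_def le_max_iff_disj)
  have "0 \<le> S" using l[OF t] norm_ge_zero order_trans by blast
  then have K: "0 \<le> K" by (simp add: K_def R_def)
  have v_le: "norm (v s) \<le> R + (LBINT r:{0..s}. norm (?f r))" if "s \<in> {0..T}" for s
  proof -
    have "norm (v s) \<le> norm x + norm (LBINT r:{0..s}. ?f r) + norm (l s)"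
      unfolding v[OF that] using norm_triangle_ineq norm_triangle_le by (metis add_right_mono)
    then show ?thesis
      using set_integral_norm_bound[OF intv[OF that]] l[OF that] by (simp add: R_def)
  qed
  \<comment> \<open>Gronwall is applied to the integral of the drift, not to \<open>norm (v s)\<close>, whose measurability in
    \<open>s\<close> would need a separate argument.\<close>
  have v_exp: "norm (v s) \<le> R * exp (m * s)" if s: "s \<in> {0..T}" for s
  proof -
    have "R + (LBINT r:{0..s}. norm (?f r)) \<le> (R + 0 * s) * exp (m * s)"
    proof (rule gronwall_norm_integral[OF intv[OF T] m(1) _ s])
      fix r assume r: "r \<in> {0..T}"
      have "norm (?f r) \<le> norm C * norm (v r)" by (rule norm_blinfun)
      also have "\<dots> \<le> m * (R + (LBINT q:{0..r}. norm (?f q)))"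
        using m v_le[OF r] by (intro mult_mono) auto
      finally show "norm (?f r) \<le> 0 * exp (m * r) + m * (R + (LBINT q:{0..r}. norm (?f q)))"
        by simp
    qed
    with v_le[OF s] show ?thesis by simp
  qed
  have intg: "set_integrable lborel {0..s} ?g" if "s \<in> {0..T}" for s
    by (intro set_integral_diff intv intw that)
  have d_le: "norm (v s - w s) \<le> (LBINT r:{0..s}. norm (?g r))" if s: "s \<in> {0..T}" for s
  proof -
    have "v s - w s = (LBINT r:{0..s}. ?g r)"
      unfolding set_integral_diff(2)[OF intv[OF s] intw[OF s]] using v[OF s] w[OF s] by simp
    then show ?thesis using set_integral_norm_bound[OF intg[OF s]] by simp
  qed
  have "0 + (LBINT r:{0..t}. norm (?g r)) \<le> (0 + K * t) * exp (m * t)"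
  proof (rule gronwall_norm_integral[OF intg[OF T] m(1) _ t])
    fix s assume s: "s \<in> {0..T}"
    have "?g s = (C - D) (v s) + D (v s - w s)"
      by (simp add: blinfun.diff_left blinfun.diff_right)
    then have "norm (?g s) \<le> norm (C - D) * norm (v s) + norm D * norm (v s - w s)"
      using norm_blinfun[of "C - D" "v s"] norm_blinfun[of D "v s - w s"]
      by (metis add_mono norm_triangle_le)
    also have "\<dots> \<le> norm (C - D) * (R * exp (m * s)) + m * (LBINT r:{0..s}. norm (?g r))"
      using m v_exp[OF s] d_le[OF s] by (intro add_mono mult_mono) auto
    finally show "norm (?g s) \<le> K * exp (m * s) + m * (0 + (LBINT r:{0..s}. norm (?g r)))"
      by (simp add: K_def)
  qed
  also have "\<dots> \<le> K * T * exp (m * T)"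
    using K t m(1) by (auto intro!: mult_mono)
  finally show ?thesis using d_le[OF t] by (simp add: K_def R_def m_def mult_ac)
qed

section \<open>Random sums and independence\<close>

lemma (in prob_space) nn_integral_partition_nat:
  fixes f :: "'a \<Rightarrow> ennreal"
  assumes [measurable]: "K \<in> M \<rightarrow>\<^sub>M count_space (UNIV :: nat set)" "f \<in> borel_measurable M"
  shows "(\<integral>\<^sup>+\<omega>. f \<omega> \<partial>M) = (\<Sum>n. \<integral>\<^sup>+\<omega>. f \<omega> * indicator {\<omega> \<in> space M. K \<omega> = n} \<omega> \<partial>M)"
proof -
  have "(\<Sum>n. f \<omega> * indicator {\<omega> \<in> space M. K \<omega> = n} \<omega>) = f \<omega>" if "\<omega> \<in> space M" for \<omega>
    by (rule suminf_cmult_indicator) (use that in \<open>auto simp: disjoint_family_on_def\<close>)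
  then have "(\<integral>\<^sup>+\<omega>. f \<omega> \<partial>M) = (\<integral>\<^sup>+\<omega>. (\<Sum>n. f \<omega> * indicator {\<omega> \<in> space M. K \<omega> = n} \<omega>) \<partial>M)"
    by (intro nn_integral_cong) simp
  also have "\<dots> = (\<Sum>n. \<integral>\<^sup>+\<omega>. f \<omega> * indicator {\<omega> \<in> space M. K \<omega> = n} \<omega> \<partial>M)"
    by (rule nn_integral_suminf) measurable
  finally show ?thesis .
qed

text \<open>Restated for sub-\<open>\<sigma>\<close>-algebras because the path of \<open>N\<close> and the sequence \<open>X\<close> take values in
  different types, whereas \<open>indep_var\<close> wants a common one. The indicator of \<open>A\<close> and \<open>g\<close> are both
  \<open>ennreal\<close>-valued, so the product formula for independent variables applies to them.\<close>

lemma (in prob_space) indep_set_nn_integral_indicator: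
  fixes g :: "'a \<Rightarrow> ennreal"
  assumes ind: "indep_set (sets F) (sets G)" and sp: "space F = space M" "space G = space M"
    and A: "A \<in> sets F" and g: "g \<in> borel_measurable G"
  shows "(\<integral>\<^sup>+\<omega>. g \<omega> * indicator A \<omega> \<partial>M) = emeasure M A * (\<integral>\<^sup>+\<omega>. g \<omega> \<partial>M)"
proof -
  note FM = indep_setD_ev1[OF ind] and GM = indep_setD_ev2[OF ind]
  have gM: "g \<in> borel_measurable M"
    using g GM sp unfolding measurable_def by auto
  have AM[measurable]: "A \<in> sets M" using A FM by auto
  have iF: "(indicator A :: 'a \<Rightarrow> ennreal) \<in> borel_measurable F" using A by measurable
  have "indep_var borel (indicator A :: 'a \<Rightarrow> ennreal) borel g"
    unfolding indep_var_eq
  proof (intro conjI)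
    show "indep_set (sigma_sets (space M) {(indicator A :: 'a \<Rightarrow> ennreal) -` B \<inter> space M |B. B \<in> sets borel})
       (sigma_sets (space M) {g -` B \<inter> space M |B. B \<in> sets borel})" (is "indep_set ?S ?S'")
    proof (rule indep_setI)
      have S: "?S \<subseteq> sets F"
        unfolding sp(1)[symmetric]
        by (rule sets.sigma_sets_subset) (use measurable_sets[OF iF] in auto)
      have S': "?S' \<subseteq> sets G"
        unfolding sp(2)[symmetric]
        by (rule sets.sigma_sets_subset) (use measurable_sets[OF g] in auto)
      show "?S \<subseteq> events" "?S' \<subseteq> events" using S S' FM GM by auto
      show "prob (a \<inter> b) = prob a * prob b" if "a \<in> ?S" "b \<in> ?S'" for a b
        using indep_setD[OF ind] S S' that by blast
    qed
  qed (use gM in auto)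
  then have "indep_vars (\<lambda>_. borel) (case_bool (indicator A) g) UNIV"
    unfolding indep_var_def by (rule indep_vars_cong[THEN iffD1, rotated -1]) (auto split: bool.split)
  from indep_vars_nn_integral[OF _ this]
  have "(\<integral>\<^sup>+\<omega>. g \<omega> * indicator A \<omega> \<partial>M) = (\<integral>\<^sup>+\<omega>. g \<omega> \<partial>M) * (\<integral>\<^sup>+\<omega>. indicator A \<omega> \<partial>M)"
    by (simp add: UNIV_bool mult.commute)
  then show ?thesis by (simp add: mult.commute)
qed

text \<open>Expand the square: the diagonal contributes \<open>card I\<close> second moments, the rest one mixed moment
  per ordered pair.\<close>

lemma nn_integral_square_sum_equal_moments:
  fixes Y :: "nat \<Rightarrow> 'a \<Rightarrow> ennreal"
  assumes [measurable]: "\<And>i. i \<in> I \<Longrightarrow> Y i \<in> borel_measurable M" and fin: "finite I"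
    and a: "\<And>i. i \<in> I \<Longrightarrow> (\<integral>\<^sup>+\<omega>. (Y i \<omega>)\<^sup>2 \<partial>M) = a"
    and c: "\<And>i j. i \<in> I \<Longrightarrow> j \<in> I \<Longrightarrow> i \<noteq> j \<Longrightarrow> (\<integral>\<^sup>+\<omega>. Y i \<omega> * Y j \<omega> \<partial>M) = c"
  shows "(\<integral>\<^sup>+\<omega>. (\<Sum>i\<in>I. Y i \<omega>)\<^sup>2 \<partial>M)
    = of_nat (card I) * a + of_nat (card I * (card I - 1)) * c"
proof -
  have inner: "(\<Sum>j\<in>I. \<integral>\<^sup>+\<omega>. Y i \<omega> * Y j \<omega> \<partial>M) = a + of_nat (card I - 1) * c" if "i \<in> I" for i
  proof -
    have "(\<Sum>j\<in>I. \<integral>\<^sup>+\<omega>. Y i \<omega> * Y j \<omega> \<partial>M)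
        = (\<integral>\<^sup>+\<omega>. Y i \<omega> * Y i \<omega> \<partial>M) + (\<Sum>j\<in>I - {i}. \<integral>\<^sup>+\<omega>. Y i \<omega> * Y j \<omega> \<partial>M)"
      using fin that by (rule sum.remove)
    also have "(\<Sum>j\<in>I - {i}. \<integral>\<^sup>+\<omega>. Y i \<omega> * Y j \<omega> \<partial>M) = (\<Sum>j\<in>I - {i}. c)"
      using that by (intro sum.cong refl c) auto
    finally show ?thesis using a[OF that] fin that by (simp add: power2_eq_square)
  qed
  have "(\<integral>\<^sup>+\<omega>. (\<Sum>i\<in>I. Y i \<omega>)\<^sup>2 \<partial>M) = (\<integral>\<^sup>+\<omega>. (\<Sum>i\<in>I. \<Sum>j\<in>I. Y i \<omega> * Y j \<omega>) \<partial>M)"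
    by (simp add: power2_eq_square sum_product)
  also have "\<dots> = (\<Sum>i\<in>I. \<Sum>j\<in>I. \<integral>\<^sup>+\<omega>. Y i \<omega> * Y j \<omega> \<partial>M)"
    by (simp add: nn_integral_sum)
  also have "\<dots> = (\<Sum>i\<in>I. a + of_nat (card I - 1) * c)" using inner by (rule sum.cong[OF refl])
  finally show ?thesis by (simp add: distrib_left mult.assoc)
qed

section \<open>The Poisson process and the jump norms\<close>

lemma poisson_weights_sums:
  fixes x :: real
  shows "(\<lambda>k. exp (- x) * x ^ k / fact k) sums 1"
proof -
  have "(\<lambda>k. exp (- x) * (x ^ k /\<^sub>R fact k)) sums (exp (- x) * exp x)"
    by (intro sums_mult exp_converges)
  then show ?thesis by (simp add: divide_inverse mult_ac flip: exp_add)
qed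

lemma poisson_weights_factorial_moments:
  fixes x :: real
  shows "(\<lambda>k. exp (- x) * x ^ k / fact k * real k) sums x"
    and "(\<lambda>k. exp (- x) * x ^ k / fact k * real (k * (k - 1))) sums x\<^sup>2"
proof -
  have 1: "exp (- x) * x ^ Suc k / fact (Suc k) * real (Suc k) = x * (exp (- x) * x ^ k / fact k)" for k
    by (simp add: field_simps del: of_nat_Suc)
  show m1: "(\<lambda>k. exp (- x) * x ^ k / fact k * real k) sums x"
    using sums_Suc[where f = "\<lambda>k. exp (- x) * x ^ k / fact k * real k", unfolded 1,
        OF sums_mult[OF poisson_weights_sums]] by simp
  have 2: "exp (- x) * x ^ Suc k / fact (Suc k) * real (Suc k * (Suc k - 1))
      = x * (exp (- x) * x ^ k / fact k * real k)" for k
    unfolding of_nat_mult mult.assoc[symmetric] 1 by simp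
  show "(\<lambda>k. exp (- x) * x ^ k / fact k * real (k * (k - 1))) sums x\<^sup>2"
    using sums_Suc[where f = "\<lambda>k. exp (- x) * x ^ k / fact k * real (k * (k - 1))", unfolded 2,
        OF sums_mult[OF m1]] by (simp add: power2_eq_square)
qed

text \<open>The increment probabilities are prescribed for nonnegative increments only, but they already
  sum to one, which leaves no mass for a decrease.\<close>

lemma (in prob_space) poisson_process_AE_le:
  assumes N: "poisson_process lam N" and st: "0 \<le> s" "s \<le> t"
  shows "AE \<omega> in M. N s \<omega> \<le> N t \<omega>"
proof -
  have [measurable]: "N s \<in> M \<rightarrow>\<^sub>M count_space UNIV" "N t \<in> M \<rightarrow>\<^sub>M count_space UNIV"
    using N st by (auto simp: poisson_process_def)
  have [measurable]: "{\<omega> \<in> space M. N t \<omega> = N s \<omega> + k} \<in> sets M" for k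
    using measurable_compose_countable[of "\<lambda>i \<omega>. N t \<omega> = i + k" M "count_space UNIV" "N s"]
    by (simp add: pred_def)
  let ?A = "\<lambda>k. {\<omega> \<in> space M. N t \<omega> = N s \<omega> + k}"
  have "(\<lambda>k. prob (?A k)) sums prob (\<Union>k. ?A k)"
    by (rule finite_measure_UNION) (auto simp: disjoint_family_on_def)
  moreover have "prob (?A k) = exp (- (lam * (t - s))) * (lam * (t - s)) ^ k / fact k" for k
    using N st by (auto simp: poisson_process_def)
  ultimately have "prob (\<Union>k. ?A k) = 1"
    using poisson_weights_sums[of "lam * (t - s)"] by (simp add: sums_unique2)
  then have "AE \<omega> in M. \<omega> \<in> (\<Union>k. ?A k)" by (rule prob_eq_1[THEN iffD1, rotated]) measurable
  then show ?thesis by eventually_elim auto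
qed

text \<open>For uncountably many \<open>t\<close> at once: discard a null set for each rational \<open>t\<close>, then approximate the
  others from the right along the right-continuous path.\<close>

lemma (in prob_space) poisson_process_AE_path_le:
  assumes N: "poisson_process lam N"
  shows "AE \<omega> in M. \<forall>t\<in>{0..T}. N t \<omega> \<le> N T \<omega>"
proof -
  have "AE \<omega> in M. \<forall>q\<in>\<rat> \<inter> {0..T}. N q \<omega> \<le> N T \<omega>"
    using poisson_process_AE_le[OF N]
    by (subst AE_ball_countable) (auto intro: countable_Int1 countable_rat)
  moreover have "AE \<omega> in M. \<forall>t\<ge>0. continuous (at_right t) (\<lambda>s. real (N s \<omega>))"
    using N unfolding poisson_process_def by (auto elim: AE_mp)
  ultimately show ?thesis
  proof eventually_elim
    case (elim \<omega>)
    show ?case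
    proof
      fix t assume t: "t \<in> {0..T}"
      show "N t \<omega> \<le> N T \<omega>"
      proof (cases "t = T")
        case False
        have lim: "((\<lambda>s. real (N s \<omega>)) \<longlongrightarrow> real (N t \<omega>)) (at_right t)"
          using elim(2) t by (auto simp: continuous_within)
        show ?thesis
        proof (rule ccontr)
          assume "\<not> N t \<omega> \<le> N T \<omega>"
          then have "\<forall>\<^sub>F s in at_right t. real (N T \<omega>) < real (N s \<omega>)"
            by (intro order_tendstoD(1)[OF lim]) simp
          then obtain b where b: "t < b" "\<And>s. t < s \<Longrightarrow> s < b \<Longrightarrow> N T \<omega> < N s \<omega>"
            unfolding eventually_at_right_field by auto
          obtain q where q: "q \<in> \<rat>" "t < q" "q < min b T"
            using Rats_dense_in_real[of t "min b T"] b(1) t False by auto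
          then have "N T \<omega> < N q \<omega>" "N q \<omega> \<le> N T \<omega>"
            using b(2)[of q] elim(1) t by auto
          then show False by simp
        qed
      qed simp
    qed
  qed
qed

lemma (in prob_space) poisson_process_distribution:
  assumes N: "poisson_process lam N" and t: "0 \<le> t"
  shows "emeasure M {\<omega> \<in> space M. N t \<omega> = k} = ennreal (exp (- (lam * t)) * (lam * t) ^ k / fact k)"
proof -
  have [measurable]: "N t \<in> M \<rightarrow>\<^sub>M count_space UNIV" "N 0 \<in> M \<rightarrow>\<^sub>M count_space UNIV"
    using N t by (auto simp: poisson_process_def)
  have [measurable]: "{\<omega> \<in> space M. N t \<omega> = N 0 \<omega> + k} \<in> sets M"
    using measurable_compose_countable[of "\<lambda>i \<omega>. N t \<omega> = i + k" M "count_space UNIV" "N 0"]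
    by (simp add: pred_def)
  have N0: "AE \<omega> in M. N 0 \<omega> = 0" using N by (auto simp: poisson_process_def)
  have "prob {\<omega> \<in> space M. N t \<omega> = k} = prob {\<omega> \<in> space M. N t \<omega> = N 0 \<omega> + k}"
    by (rule finite_measure_eq_AE) (use N0 in \<open>auto elim!: AE_mp\<close>)
  also have "\<dots> = exp (- (lam * (t - 0))) * (lam * (t - 0)) ^ k / fact k"
    using N t unfolding poisson_process_def by blast
  finally show ?thesis by (simp add: emeasure_eq_measure)
qed

text \<open>Condition on the number of jumps. Given \<open>N T = k\<close>, independence makes the second moment
  \<open>k a + k (k - 1) b\<^sup>2\<close> with \<open>a\<close> and \<open>b\<close> the second and first moments of \<open>norm (X 1)\<close>, and the first two
  factorial moments of the Poisson law are \<open>lam T\<close> and \<open>(lam T)\<^sup>2\<close>.\<close>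

lemma (in prob_space) compound_poisson_jump_norms_second_moment:
  fixes X :: "nat \<Rightarrow> 'a \<Rightarrow> 'b::{banach,second_countable_topology}"
  assumes cp: "compound_poisson lam N X L" and T: "0 \<le> T"
  shows "(\<integral>\<^sup>+\<omega>. ennreal ((\<Sum>i=1..N T \<omega>. norm (X i \<omega>))\<^sup>2) \<partial>M)
    = ennreal (lam * T) * (\<integral>\<^sup>+\<omega>. ennreal ((norm (X 1 \<omega>))\<^sup>2) \<partial>M)
      + ennreal (lam\<^sup>2 * T\<^sup>2) * (\<integral>\<^sup>+\<omega>. ennreal (norm (X 1 \<omega>)) \<partial>M)\<^sup>2"
proof -
  define Y where "Y i \<omega> = ennreal (norm (X i \<omega>))" for i \<omega>
  define a where "a = (\<integral>\<^sup>+\<omega>. ennreal ((norm (X 1 \<omega>))\<^sup>2) \<partial>M)"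
  define b where "b = (\<integral>\<^sup>+\<omega>. ennreal (norm (X 1 \<omega>)) \<partial>M)"
  define p where "p k = exp (- (lam * T)) * (lam * T) ^ k / fact k" for k
  have lam: "0 < lam" and N: "poisson_process lam N" and iid: "iid_sequence X"
    and ind: "indep_of_process N X"
    using cp by (auto simp: compound_poisson_def)
  have indX: "indep_vars (\<lambda>_. borel) X {1..}" and
      distr: "i \<ge> 1 \<Longrightarrow> distr M borel (X i) = distr M borel (X 1)" for i
    using iid unfolding iid_sequence_def by blast+
  have X[measurable]: "i \<ge> 1 \<Longrightarrow> X i \<in> borel_measurable M" for i
    using indX by (auto simp: indep_vars_def)
  have Y[measurable]: "i \<ge> 1 \<Longrightarrow> Y i \<in> borel_measurable M" for i
    unfolding Y_def[abs_def] by measurable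
  have [measurable]: "N T \<in> M \<rightarrow>\<^sub>M count_space UNIV"
    using N T by (auto simp: poisson_process_def)
  have same: "(\<integral>\<^sup>+\<omega>. h (X i \<omega>) \<partial>M) = (\<integral>\<^sup>+\<omega>. h (X 1 \<omega>) \<partial>M)"
    if "i \<ge> 1" and [measurable]: "h \<in> borel_measurable borel" for i and h :: "'b \<Rightarrow> ennreal"
    using nn_integral_distr[of "X i" M borel h] nn_integral_distr[of "X 1" M borel h] distr[OF that(1)] X that
    by simp
  have EY2: "(\<integral>\<^sup>+\<omega>. (Y i \<omega>)\<^sup>2 \<partial>M) = a" if "i \<ge> 1" for i
    using same[OF that, of "\<lambda>x. ennreal ((norm x)\<^sup>2)"] by (simp add: Y_def a_def ennreal_power)
  have EY: "(\<integral>\<^sup>+\<omega>. Y i \<omega> \<partial>M) = b" if "i \<ge> 1" for i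
    using same[OF that, of "\<lambda>x. ennreal (norm x)"] by (simp add: Y_def b_def)
  have cov: "(\<integral>\<^sup>+\<omega>. Y i \<omega> * Y j \<omega> \<partial>M) = b\<^sup>2" if "i \<ge> 1" "j \<ge> 1" "i \<noteq> j" for i j
  proof -
    have "indep_vars (\<lambda>_. borel) X {i, j}"
      using indX by (rule indep_vars_subset) (use that in auto)
    then have "indep_vars (\<lambda>_. borel) Y {i, j}"
      using indep_vars_compose2[where Y = "\<lambda>_ x. ennreal (norm x)" and N = "\<lambda>_. borel"]
      unfolding Y_def[abs_def] by force
    from indep_vars_nn_integral[OF _ this] show ?thesis
      using that EY by (simp add: power2_eq_square)
  qed
  have square: "(\<integral>\<^sup>+\<omega>. (\<Sum>i=1..k. Y i \<omega>)\<^sup>2 \<partial>M) = of_nat k * a + of_nat (k * (k - 1)) * b\<^sup>2" for k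
    using nn_integral_square_sum_equal_moments[of "{1..k}" Y M a "b\<^sup>2"] EY2 cov by simp
  let ?F = "vimage_algebra (space M) (\<lambda>\<omega>. \<lambda>t\<in>{0..}. N t \<omega>) (Pi\<^sub>M {0..} (\<lambda>_. count_space UNIV))"
  let ?G = "vimage_algebra (space M) (\<lambda>\<omega>. \<lambda>i\<in>{1..}. X i \<omega>) (Pi\<^sub>M {1..} (\<lambda>_. borel))"
  have NF: "N T \<in> ?F \<rightarrow>\<^sub>M count_space UNIV"
  proof -
    have "(\<lambda>\<omega>. \<lambda>t\<in>{0..}. N t \<omega>) \<in> ?F \<rightarrow>\<^sub>M Pi\<^sub>M {0..} (\<lambda>_. count_space UNIV)"
      by (rule measurable_vimage_algebra1) (auto simp: space_PiM)
    from measurable_compose[OF this measurable_component_singleton[of T]] T show ?thesis by simp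
  qed
  have XG: "X i \<in> borel_measurable ?G" if "i \<ge> 1" for i
  proof -
    have "(\<lambda>\<omega>. \<lambda>i\<in>{1..}. X i \<omega>) \<in> ?G \<rightarrow>\<^sub>M Pi\<^sub>M {1..} (\<lambda>_. borel)"
      by (rule measurable_vimage_algebra1) (auto simp: space_PiM)
    from measurable_compose[OF this measurable_component_singleton[of i]] that show ?thesis by simp
  qed
  have level: "(\<integral>\<^sup>+\<omega>. (\<Sum>i=1..N T \<omega>. Y i \<omega>)\<^sup>2 * indicator {\<omega> \<in> space M. N T \<omega> = k} \<omega> \<partial>M)
      = ennreal (p k * real k) * a + ennreal (p k * real (k * (k - 1))) * b\<^sup>2" for k
  proof -
    have p0: "0 \<le> p k" using lam T by (simp add: p_def)
    have A: "{\<omega> \<in> space M. N T \<omega> = k} \<in> sets ?F"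
      using measurable_sets[OF NF, of "{k}"] by (simp add: vimage_def Int_def conj_commute)
    have g: "(\<lambda>\<omega>. (\<Sum>i=1..k. Y i \<omega>)\<^sup>2) \<in> borel_measurable ?G"
      using XG unfolding Y_def power2_eq_square by (intro borel_measurable_times_ennreal borel_measurable_sum) auto
    have "(\<integral>\<^sup>+\<omega>. (\<Sum>i=1..N T \<omega>. Y i \<omega>)\<^sup>2 * indicator {\<omega> \<in> space M. N T \<omega> = k} \<omega> \<partial>M)
        = (\<integral>\<^sup>+\<omega>. (\<Sum>i=1..k. Y i \<omega>)\<^sup>2 * indicator {\<omega> \<in> space M. N T \<omega> = k} \<omega> \<partial>M)"
      by (intro nn_integral_cong) (auto simp: indicator_def)
    also have "\<dots> = emeasure M {\<omega> \<in> space M. N T \<omega> = k} * (\<integral>\<^sup>+\<omega>. (\<Sum>i=1..k. Y i \<omega>)\<^sup>2 \<partial>M)"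
      by (rule indep_set_nn_integral_indicator[OF ind[unfolded indep_of_process_def] _ _ A g]) auto
    also have "\<dots> = ennreal (p k) * (ennreal (real k) * a + ennreal (real (k * (k - 1))) * b\<^sup>2)"
      unfolding square poisson_process_distribution[OF N T] p_def
      by (simp only: ennreal_of_nat_eq_real_of_nat)
    also have "\<dots> = ennreal (p k * real k) * a + ennreal (p k * real (k * (k - 1))) * b\<^sup>2"
      using p0 by (simp add: distrib_left ennreal_mult mult.assoc del: of_nat_mult)
    finally show ?thesis .
  qed
  have "(\<lambda>\<omega>. \<Sum>i=1..N T \<omega>. Y i \<omega>) \<in> borel_measurable M"
    by (rule measurable_compose_countable'[where g = "N T" and I = UNIV]) auto
  then have "(\<lambda>\<omega>. (\<Sum>i=1..N T \<omega>. Y i \<omega>)\<^sup>2) \<in> borel_measurable M" by measurable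
  then have "(\<integral>\<^sup>+\<omega>. (\<Sum>i=1..N T \<omega>. Y i \<omega>)\<^sup>2 \<partial>M)
      = (\<Sum>k. ennreal (p k * real k) * a + ennreal (p k * real (k * (k - 1))) * b\<^sup>2)"
    by (subst nn_integral_partition_nat[of "N T"]) (simp_all only: level, measurable)
  also have "\<dots> = (\<Sum>k. ennreal (p k * real k)) * a + (\<Sum>k. ennreal (p k * real (k * (k - 1)))) * b\<^sup>2"
    by (simp add: suminf_add[symmetric] del: of_nat_mult)
  also have "(\<Sum>k. ennreal (p k * real k)) = ennreal (lam * T)"
    unfolding p_def by (rule suminf_ennreal_eq[OF _ poisson_weights_factorial_moments(1)])
      (use lam T in simp)
  also have "(\<Sum>k. ennreal (p k * real (k * (k - 1)))) = ennreal (lam\<^sup>2 * T\<^sup>2)"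
    unfolding p_def power_mult_distrib[symmetric]
    by (rule suminf_ennreal_eq[OF _ poisson_weights_factorial_moments(2)])
      (use lam T in simp)
  finally show ?thesis
    by (simp add: Y_def a_def b_def sum_nonneg ennreal_power)
qed

lemma (in prob_space) compound_poisson_jump_norms_measurable:
  fixes X :: "nat \<Rightarrow> 'a \<Rightarrow> 'b::{banach,second_countable_topology}"
  assumes cp: "compound_poisson lam N X L" and T: "0 \<le> T"
  shows "(\<lambda>\<omega>. \<Sum>i=1..N T \<omega>. norm (X i \<omega>)) \<in> borel_measurable M"
proof -
  have [measurable]: "N T \<in> M \<rightarrow>\<^sub>M count_space UNIV" "\<And>i. i \<ge> 1 \<Longrightarrow> X i \<in> borel_measurable M"
    using cp T
    by (auto simp: compound_poisson_def poisson_process_def iid_sequence_def indep_vars_def)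
  show ?thesis
    by (rule measurable_compose_countable'[where g = "N T" and I = UNIV]) auto
qed

section \<open>The perturbation estimate\<close>

text \<open>The pathwise bound makes sense in every separable Banach space, and so does the estimate.
  \<open>(x + y)\<^sup>2 \<le> 2 (x\<^sup>2 + y\<^sup>2)\<close> separates the initial value from the jumps in the
  expectation; this is the origin of the factor 2.\<close>

theorem (in prob_space) linear_sde_perturbation_mean_square:
  fixes C D :: "'b::{banach,second_countable_topology} \<Rightarrow>\<^sub>L 'b"
    and X :: "nat \<Rightarrow> 'a \<Rightarrow> 'b"
  assumes V0[measurable]: "V0 \<in> borel_measurable M"
    and cp: "compound_poisson lam N X L"
    and V: "solves_linear_sde C V0 L V" and W: "solves_linear_sde D V0 L W"
    and T: "0 \<le> T"
  shows "(\<integral>\<^sup>+\<omega>. (SUP t\<in>{0..T}. ennreal ((norm (V t \<omega> - W t \<omega>))\<^sup>2)) \<partial>M)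
    \<le> ennreal (2 * T\<^sup>2 * exp (2 * T * max (norm C) (norm D))) *
        ((\<integral>\<^sup>+\<omega>. ennreal ((norm (V0 \<omega>))\<^sup>2) \<partial>M)
          + ennreal (lam * T) * (\<integral>\<^sup>+\<omega>. ennreal ((norm (X 1 \<omega>))\<^sup>2) \<partial>M)
          + ennreal (lam\<^sup>2 * T\<^sup>2) * (\<integral>\<^sup>+\<omega>. ennreal (norm (X 1 \<omega>)) \<partial>M)\<^sup>2)
      * ennreal ((norm (C - D))\<^sup>2)"
proof -
  define S where "S \<omega> = (\<Sum>i=1..N T \<omega>. norm (X i \<omega>))" for \<omega>
  define A where "A = 2 * T\<^sup>2 * exp (2 * T * max (norm C) (norm D))"
  define K where "K = T * exp (T * max (norm C) (norm D)) * norm (C - D)"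
  have A: "0 \<le> A" by (simp add: A_def)
  have K2: "2 * K\<^sup>2 = A * (norm (C - D))\<^sup>2"
    by (simp add: K_def A_def power_mult_distrib mult_ac flip: exp_double)
  have [measurable]: "S \<in> borel_measurable M"
    unfolding S_def using compound_poisson_jump_norms_measurable[OF cp T] .
  have L: "L t \<omega> = (\<Sum>i=1..N t \<omega>. X i \<omega>)" if "0 \<le> t" "\<omega> \<in> space M" for t \<omega>
    using cp that by (auto simp: compound_poisson_def)
  have "AE \<omega> in M. \<forall>t\<in>{0..T}. N t \<omega> \<le> N T \<omega>"
    using cp poisson_process_AE_path_le by (auto simp: compound_poisson_def)
  moreover have "AE \<omega> in M. \<forall>t\<ge>0. set_integrable lborel {0..t} (\<lambda>s. C (V s \<omega>)) \<and>
      V t \<omega> = V0 \<omega> + (LBINT s:{0..t}. C (V s \<omega>)) + L t \<omega>"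
    using V by (simp add: solves_linear_sde_def)
  moreover have "AE \<omega> in M. \<forall>t\<ge>0. set_integrable lborel {0..t} (\<lambda>s. D (W s \<omega>)) \<and>
      W t \<omega> = V0 \<omega> + (LBINT s:{0..t}. D (W s \<omega>)) + L t \<omega>"
    using W by (simp add: solves_linear_sde_def)
  \<comment> \<open>The supremum over \<open>t\<close> need not be measurable, so it is dominated pathwise by a measurable
    function before integrating.\<close>
  ultimately have path: "AE \<omega> in M. (SUP t\<in>{0..T}. ennreal ((norm (V t \<omega> - W t \<omega>))\<^sup>2))
      \<le> ennreal (2 * K\<^sup>2) * (ennreal ((norm (V0 \<omega>))\<^sup>2) + ennreal ((S \<omega>)\<^sup>2))"
    using AE_space
  proof eventually_elim
    case (elim \<omega>)
    have "norm (L t \<omega>) \<le> S \<omega>" if t: "t \<in> {0..T}" for t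
    proof -
      have "norm (L t \<omega>) \<le> (\<Sum>i=1..N t \<omega>. norm (X i \<omega>))"
        using L[of t \<omega>] elim(4) t by (simp add: norm_sum)
      also have "\<dots> \<le> S \<omega>"
        unfolding S_def using elim(1) t by (intro sum_mono2) auto
      finally show ?thesis .
    qed
    then have bound: "norm (V t \<omega> - W t \<omega>) \<le> K * (norm (V0 \<omega>) + S \<omega>)" if "t \<in> {0..T}" for t
      using linear_equation_perturbation[of T C "\<lambda>t. V t \<omega>" "V0 \<omega>" "\<lambda>t. L t \<omega>" D "\<lambda>t. W t \<omega>" "S \<omega>" t]
        elim(2,3) that by (simp add: K_def mult_ac)
    show ?case
    proof (rule SUP_least)
      fix t assume "t \<in> {0..T}"
      then have "(norm (V t \<omega> - W t \<omega>))\<^sup>2 \<le> (K * (norm (V0 \<omega>) + S \<omega>))\<^sup>2"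
        by (intro power_mono bound) auto
      also have "\<dots> \<le> K\<^sup>2 * (2 * ((norm (V0 \<omega>))\<^sup>2 + (S \<omega>)\<^sup>2))"
        unfolding power_mult_distrib using sum_squares_bound[of "norm (V0 \<omega>)" "S \<omega>"]
        by (intro mult_left_mono) (auto simp: power2_sum)
      finally have "ennreal ((norm (V t \<omega> - W t \<omega>))\<^sup>2)
          \<le> ennreal (2 * K\<^sup>2 * ((norm (V0 \<omega>))\<^sup>2 + (S \<omega>)\<^sup>2))"
        by (intro ennreal_leI) (simp add: algebra_simps)
      then show "ennreal ((norm (V t \<omega> - W t \<omega>))\<^sup>2)
          \<le> ennreal (2 * K\<^sup>2) * (ennreal ((norm (V0 \<omega>))\<^sup>2) + ennreal ((S \<omega>)\<^sup>2))"
        by (simp add: ennreal_mult ennreal_plus[symmetric] del: ennreal_plus)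
    qed
  qed
  have "(\<integral>\<^sup>+\<omega>. (SUP t\<in>{0..T}. ennreal ((norm (V t \<omega> - W t \<omega>))\<^sup>2)) \<partial>M)
      \<le> (\<integral>\<^sup>+\<omega>. ennreal (2 * K\<^sup>2) * (ennreal ((norm (V0 \<omega>))\<^sup>2) + ennreal ((S \<omega>)\<^sup>2)) \<partial>M)"
    by (rule nn_integral_mono_AE[OF path])
  also have "\<dots> = ennreal (2 * K\<^sup>2) *
      ((\<integral>\<^sup>+\<omega>. ennreal ((norm (V0 \<omega>))\<^sup>2) \<partial>M) + (\<integral>\<^sup>+\<omega>. ennreal ((S \<omega>)\<^sup>2) \<partial>M))"
    by (subst nn_integral_cmult) (measurable, simp add: nn_integral_add)
  finally show ?thesis
    unfolding S_def compound_poisson_jump_norms_second_moment[OF cp T] K2 A_def[symmetric]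
      ennreal_mult[OF A zero_le_power2]
    by (simp only: mult_ac add.assoc)
qed

theorem proposition6:
  fixes M :: "'w measure"
    and C :: "'h::{real_inner,banach,second_countable_topology} hs_op \<Rightarrow>\<^sub>L 'h hs_op"
    and Cn :: "nat \<Rightarrow> 'h hs_op \<Rightarrow>\<^sub>L 'h hs_op"
    and lam :: real
    and N :: "real \<Rightarrow> 'w \<Rightarrow> nat"
    and X :: "nat \<Rightarrow> 'w \<Rightarrow> 'h hs_op"
    and L V :: "real \<Rightarrow> 'w \<Rightarrow> 'h hs_op"
    and Ln Vn :: "nat \<Rightarrow> real \<Rightarrow> 'w \<Rightarrow> 'h hs_op"
    and V0 :: "'w \<Rightarrow> 'h hs_op"
    and V0n :: "nat \<Rightarrow> 'w \<Rightarrow> 'h hs_op"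
  assumes "prob_space M"
    and "V0 \<in> borel_measurable M"
    and "prob_space.compound_poisson M lam N X L"
    and "prob_space.square_integrable_process M L"
    and "prob_space.solves_linear_sde M C V0 L V"
    and "\<forall>n\<ge>1. prob_space.solves_linear_sde M (Cn n) (V0n n) (Ln n) (Vn n)"
    and "\<forall>n\<ge>1. V0n n = V0 \<and> Ln n = L"
  shows "\<forall>n\<ge>1. \<forall>T>0.
    (\<integral>\<^sup>+ \<omega>. (SUP t\<in>{0..T}. ennreal ((norm (V t \<omega> - Vn n t \<omega>))\<^sup>2)) \<partial>M)
    \<le> ennreal (2 * T\<^sup>2 * exp (2 * T * max (norm C) (norm (Cn n)))) *
        ((\<integral>\<^sup>+ \<omega>. ennreal ((norm (V0 \<omega>))\<^sup>2) \<partial>M)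
          + ennreal (lam * T) * (\<integral>\<^sup>+ \<omega>. ennreal ((norm (X 1 \<omega>))\<^sup>2) \<partial>M)
          + ennreal (lam\<^sup>2 * T\<^sup>2) * (\<integral>\<^sup>+ \<omega>. ennreal (norm (X 1 \<omega>)) \<partial>M)\<^sup>2)
      * ennreal ((norm (C - Cn n))\<^sup>2)"
proof (intro allI impI)
  fix n :: nat and T :: real assume n: "1 \<le> n" and T: "0 < T"
  interpret prob_space M by fact
  have "solves_linear_sde (Cn n) V0 L (Vn n)" using assms(6,7) n by auto
  from linear_sde_perturbation_mean_square[OF assms(2,3,5) this] T
  show "(\<integral>\<^sup>+ \<omega>. (SUP t\<in>{0..T}. ennreal ((norm (V t \<omega> - Vn n t \<omega>))\<^sup>2)) \<partial>M)
    \<le> ennreal (2 * T\<^sup>2 * exp (2 * T * max (norm C) (norm (Cn n)))) *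
        ((\<integral>\<^sup>+ \<omega>. ennreal ((norm (V0 \<omega>))\<^sup>2) \<partial>M)
          + ennreal (lam * T) * (\<integral>\<^sup>+ \<omega>. ennreal ((norm (X 1 \<omega>))\<^sup>2) \<partial>M)
          + ennreal (lam\<^sup>2 * T\<^sup>2) * (\<integral>\<^sup>+ \<omega>. ennreal (norm (X 1 \<omega>)) \<partial>M)\<^sup>2)
      * ennreal ((norm (C - Cn n))\<^sup>2)"
    by simp
qed

end
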